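(* Let $\Phi:\mathbb{M}(n)\to\mathbb{M}(k)$ be a positive unital linear map. Let $A\in\mathbb{M}(n)$ be a Hermitian matrix whose distinct eigenvalues are $\lambda_1<\lambda_2<\cdots<\lambda_p$. Then for every $l\in\{2,3,\ldots,p\}$ and every $r=0,1,2,\ldots$, $$\left[\Phi\left(A^{i+j-2}(A-\lambda_{l-1}I)(A-\lambda_l I)\right)\right]_{1\le i,j\le r+1}\ge O.$$
   Context: $\mathbb{M}(n)$ is the $C^*$-algebra of all $n\times n$ complex matrices. A linear map $\Phi:\mathbb{M}(n)\to\mathbb{M}(k)$ is positive if it sends positive semidefinite matrices to positive semidefinite matrices, and unital if $\Phi(I)=I$. $[X_{ij}]_{1\le i,j\le r+1}$ with $X_{ij}\in\mathbb{M}(k)$ denotes the $(r+1)\times(r+1)$ block matrix with blocks $X_{ij}$, viewed as an element of $\mathbb{M}((r+1)k)$. $X\ge O$ means $X$ is Hermitian positive semidefinite. $A^0=I$. *)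

theory Defs
  imports "Jordan_Normal_Form.Spectral_Radius"
begin

definition hermitian :: "complex mat \<Rightarrow> bool" where
  "hermitian A \<longleftrightarrow> mat_adjoint A = A"

text \<open>The inequality is in the order on the complex numbers in which \<open>0 \<le> z\<close> means that \<open>z\<close> is
  real and nonnegative. The relation \<open>\<le>\<close> on type \<open>complex mat\<close> is the entrywise one, so
  \<open>A \<ge> O\<close> has to be rendered by this predicate.\<close>

definition psd :: "complex mat \<Rightarrow> bool" where
  "psd A \<longleftrightarrow> hermitian A \<and> (\<forall>v \<in> carrier_vec (dim_row A). 0 \<le> (A *\<^sub>v v) \<bullet>c v)"

definition linear_mat_map :: "nat \<Rightarrow> nat \<Rightarrow> (complex mat \<Rightarrow> complex mat) \<Rightarrow> bool" where
  "linear_mat_map n k \<Phi> \<longleftrightarrow>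
     \<Phi> \<in> carrier_mat n n \<rightarrow> carrier_mat k k \<and>
     (\<forall>X \<in> carrier_mat n n. \<forall>Y \<in> carrier_mat n n. \<Phi> (X + Y) = \<Phi> X + \<Phi> Y) \<and>
     (\<forall>c. \<forall>X \<in> carrier_mat n n. \<Phi> (c \<cdot>\<^sub>m X) = c \<cdot>\<^sub>m \<Phi> X)"

definition positive_mat_map :: "nat \<Rightarrow> (complex mat \<Rightarrow> complex mat) \<Rightarrow> bool" where
  "positive_mat_map n \<Phi> \<longleftrightarrow> (\<forall>X \<in> carrier_mat n n. psd X \<longrightarrow> psd (\<Phi> X))"

definition unital_mat_map :: "nat \<Rightarrow> nat \<Rightarrow> (complex mat \<Rightarrow> complex mat) \<Rightarrow> bool" where
  "unital_mat_map n k \<Phi> \<longleftrightarrow> \<Phi> (1\<^sub>m n) = 1\<^sub>m k"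

text \<open>The \<open>m \<times> m\<close> block matrix of \<open>k \<times> k\<close> blocks \<open>X i j\<close>. The block indices
  \<open>i, j\<close> run from 1 to \<open>m\<close>, whereas matrix entries are indexed from 0.\<close>

definition block_matrix :: "nat \<Rightarrow> nat \<Rightarrow> (nat \<Rightarrow> nat \<Rightarrow> complex mat) \<Rightarrow> complex mat" where
  "block_matrix m k X =
     mat (m * k) (m * k) (\<lambda>(a, b). X (a div k + 1) (b div k + 1) $$ (a mod k, b mod k))"

lemma block_matrix_index:
  assumes "i \<in> {1..m}" "j \<in> {1..m}" "a < k" "b < k"
  shows "block_matrix m k X $$ ((i - 1) * k + a, (j - 1) * k + b) = X i j $$ (a, b)"
proof -
  have *: "(i - 1) * k + a < m * k" if "i \<in> {1..m}" "a < k" for i a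
  proof -
    have "(i - 1) * k + a < (i - 1 + 1) * k" unfolding add_mult_distrib using that(2) by simp
    also have "\<dots> \<le> m * k" using that by (intro mult_right_mono) auto
    finally show ?thesis .
  qed
  show ?thesis
    unfolding block_matrix_def using assms *[of i a] *[of j b] by simp
qed

end

theory Submission
  imports Defs "Jordan_Normal_Form.Jordan_Normal_Form_Uniqueness"
begin

text \<open>Write \<open>A = \<Sum>\<mu>. \<mu> E\<^sub>\<mu>\<close> with the spectral projections \<open>E\<^sub>\<mu> \<ge> O\<close>. Then
  \<open>\<Phi>(A\<^sup>m (A - a I) (A - b I)) = \<Sum>\<mu>. \<mu>\<^sup>m c\<^sub>\<mu> \<Phi>(E\<^sub>\<mu>)\<close> with \<open>c\<^sub>\<mu> = (\<mu> - a) (\<mu> - b)\<close>, and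
  \<open>c\<^sub>\<mu> \<ge> 0\<close> on the spectrum because \<open>a\<close> and \<open>b\<close> are consecutive eigenvalues. Hence the block matrix
  is the sum over \<open>\<mu>\<close> of the matrices with blocks \<open>c\<^sub>\<mu> \<mu>\<^sup>i \<mu>\<^sup>j \<Phi>(E\<^sub>\<mu>)\<close>, each of which is
  congruent to \<open>\<Phi>(E\<^sub>\<mu>) \<ge> O\<close>. That a Hermitian matrix is diagonalizable is read off its Jordan
  normal form: the kernels of \<open>A - e I\<close> and \<open>(A - e I)\<^sup>2\<close> agree, so every block has size 1.\<close>

section \<open>Hermitian and positive semidefinite matrices in terms of entries\<close>

lemma hermitian_index:
  assumes "hermitian A" "A \<in> carrier_mat n n" "i < n" "j < n"
  shows "A $$ (j, i) = cnj (A $$ (i, j))"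
proof -
  have "mat_adjoint A $$ (j, i) = cnj (A $$ (i, j))"
    using assms(2-4) by (simp add: mat_adjoint_def mat_of_rows_def)
  then show ?thesis using assms(1) by (simp add: hermitian_def)
qed

lemma hermitianI:
  assumes "A \<in> carrier_mat n n" "\<And>i j. i < n \<Longrightarrow> j < n \<Longrightarrow> A $$ (j, i) = cnj (A $$ (i, j))"
  shows "hermitian A"
  unfolding hermitian_def
proof (rule eq_matI)
  fix i j assume "i < dim_row A" "j < dim_col A"
  then show "mat_adjoint A $$ (i, j) = A $$ (i, j)"
    using assms(1) assms(2)[of j i] by (simp add: mat_adjoint_def mat_of_rows_def)
qed (use assms(1) in \<open>auto simp: mat_adjoint_def mat_of_rows_def\<close>)

lemma quadratic_form_eq_sum:
  assumes "A \<in> carrier_mat n n" "v \<in> carrier_vec n" "w \<in> carrier_vec n"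
  shows "(A *\<^sub>v v) \<bullet>c w = (\<Sum>i<n. \<Sum>j<n. A $$ (i, j) * v $ j * cnj (w $ i))"
  using assms by (simp add: scalar_prod_def sum_distrib_right atLeast0LessThan)

lemma hermitian_cscalar_prod_swap:
  assumes "hermitian A" "A \<in> carrier_mat n n" "v \<in> carrier_vec n" "w \<in> carrier_vec n"
  shows "(A *\<^sub>v v) \<bullet>c w = v \<bullet>c (A *\<^sub>v w)"
proof -
  have "(A *\<^sub>v v) \<bullet>c w = (\<Sum>j<n. \<Sum>i<n. A $$ (i, j) * v $ j * cnj (w $ i))"
    using assms by (subst quadratic_form_eq_sum) (auto intro: sum.swap)
  also have "\<dots> = v \<bullet>c (A *\<^sub>v w)"
  proof -
    have "v \<bullet>c (A *\<^sub>v w) = (\<Sum>j<n. \<Sum>i<n. v $ j * (cnj (A $$ (j, i)) * cnj (w $ i)))"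
      using assms(2-4) by (simp add: scalar_prod_def sum_distrib_left atLeast0LessThan)
    also have "\<dots> = (\<Sum>j<n. \<Sum>i<n. A $$ (i, j) * v $ j * cnj (w $ i))"
    proof (intro sum.cong refl)
      fix i j assume "i \<in> {..<n}" "j \<in> {..<n}"
      then show "v $ j * (cnj (A $$ (j, i)) * cnj (w $ i)) = A $$ (i, j) * v $ j * cnj (w $ i)"
        using hermitian_index[OF assms(1,2), of j i] by simp
    qed
    finally show ?thesis by simp
  qed
  finally show ?thesis .
qed

text \<open>Test vectors become functions on \<open>nat\<close>, of which only the values below
  \<open>n\<close> matter. Without carrier conditions, positivity can be proved by rearranging plain
  double sums.\<close>

lemma psd_iff_sum:
  assumes "A \<in> carrier_mat n n"
  shows "psd A \<longleftrightarrow> (\<forall>i<n. \<forall>j<n. A $$ (j, i) = cnj (A $$ (i, j)))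
    \<and> (\<forall>v. 0 \<le> (\<Sum>i<n. \<Sum>j<n. A $$ (i, j) * v j * cnj (v i)))"
    (is "_ \<longleftrightarrow> ?H \<and> (\<forall>v. 0 \<le> ?q v)")
proof -
  have "hermitian A \<longleftrightarrow> ?H"
    using hermitian_index[OF _ assms] hermitianI[OF assms] by blast
  moreover have "(\<forall>v \<in> carrier_vec n. 0 \<le> (A *\<^sub>v v) \<bullet>c v) \<longleftrightarrow> (\<forall>v. 0 \<le> ?q v)"
  proof safe
    fix v assume "\<forall>v \<in> carrier_vec n. 0 \<le> (A *\<^sub>v v) \<bullet>c v"
    then have "0 \<le> (A *\<^sub>v vec n v) \<bullet>c vec n v" by simp
    then show "0 \<le> ?q v" by (simp add: quadratic_form_eq_sum[OF assms])
  next
    fix v :: "complex vec" assume "\<forall>v. 0 \<le> ?q v" "v \<in> carrier_vec n"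
    then show "0 \<le> (A *\<^sub>v v) \<bullet>c v" by (simp add: quadratic_form_eq_sum[OF assms])
  qed
  ultimately show ?thesis using assms by (simp add: psd_def)
qed

section \<open>Diagonalization of Hermitian matrices\<close>

lemma char_matrix_mult_vec:
  assumes "A \<in> carrier_mat n n" "v \<in> carrier_vec n"
  shows "char_matrix A e *\<^sub>v v = A *\<^sub>v v - e \<cdot>\<^sub>v v"
proof -
  have "((- e) \<cdot>\<^sub>m 1\<^sub>m n) *\<^sub>v v = (- e) \<cdot>\<^sub>v v"
    using assms(2) by (intro eq_vecI) auto
  then have "char_matrix A e *\<^sub>v v = A *\<^sub>v v + (- e) \<cdot>\<^sub>v v"
    using assms unfolding char_matrix_def by (subst add_mult_distrib_mat_vec[of _ n n]) auto
  then show ?thesis using assms by auto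
qed

text \<open>For an eigenvector \<open>y\<close>, moving \<open>A\<close> across the inner product of
  \<open>A *\<^sub>v y\<close> with \<open>y\<close> turns the factor \<open>e\<close> into
  \<open>cnj e\<close>.\<close>

lemma hermitian_spectrum_real:
  assumes "hermitian A" "A \<in> carrier_mat n n" "e \<in> spectrum A"
  shows "cnj e = e"
proof -
  obtain y where y: "y \<in> carrier_vec n" "y \<noteq> 0\<^sub>v n" and ev: "A *\<^sub>v y = e \<cdot>\<^sub>v y"
    using assms(2,3) by (auto simp: spectrum_def eigenvalue_def eigenvector_def)
  have "e * (y \<bullet>c y) = (A *\<^sub>v y) \<bullet>c y" using y by (simp add: ev)
  also have "\<dots> = y \<bullet>c (A *\<^sub>v y)" by (rule hermitian_cscalar_prod_swap[OF assms(1,2) y(1) y(1)])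
  also have "\<dots> = cnj e * (y \<bullet>c y)" using y by (simp add: ev conjugate_smult_vec)
  finally show ?thesis using y by simp
qed

text \<open>If y = (A - e I) v were nonzero, it would be an eigenvector for \<open>e\<close>, so
  \<open>e\<close> would be real and A - e I could be moved across: <y, y> = <v, (A - e I) y> = 0.
  This rules out Jordan blocks of size 2 or more.\<close>

lemma hermitian_generalized_eigenvector:
  assumes "hermitian A" "A \<in> carrier_mat n n" "v \<in> carrier_vec n"
    and "char_matrix A e *\<^sub>v (char_matrix A e *\<^sub>v v) = 0\<^sub>v n"
  shows "char_matrix A e *\<^sub>v v = 0\<^sub>v n"
proof (rule ccontr)
  define y where "y = char_matrix A e *\<^sub>v v"
  assume "char_matrix A e *\<^sub>v v \<noteq> 0\<^sub>v n"
  then have y0: "y \<noteq> 0\<^sub>v n" by (simp add: y_def)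
  have cA: "char_matrix A e \<in> carrier_mat n n" using assms(2) by simp
  have y: "y \<in> carrier_vec n" using cA assms(3) by (simp add: y_def)
  have eig: "eigenvector A y e"
    using y y0 assms(4) eigenvector_char_matrix[OF assms(2)] by (simp add: y_def)
  then have ev: "A *\<^sub>v y = e \<cdot>\<^sub>v y" by (simp add: eigenvector_def)
  have yy: "y \<bullet>c y \<noteq> 0" using y y0 by simp
  have e: "cnj e = e"
    by (rule hermitian_spectrum_real[OF assms(1,2)]) (use eig in \<open>auto simp: spectrum_def eigenvalue_def\<close>)
  \<comment> \<open>Only the first factor \<open>y\<close> is expanded; the second stays an
    eigenvector, on which \<open>A\<close> acts as \<open>e\<close>.\<close>
  have "y \<bullet>c y = (A *\<^sub>v v) \<bullet>c y - e * (v \<bullet>c y)"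
    using assms(2,3) y unfolding y_def[unfolded char_matrix_mult_vec[OF assms(2,3)]]
    by (subst minus_scalar_prod_distrib[of _ n]) (auto simp: y_def)
  also have "(A *\<^sub>v v) \<bullet>c y = v \<bullet>c (A *\<^sub>v y)"
    by (rule hermitian_cscalar_prod_swap[OF assms(1,2,3) y])
  also have "\<dots> = e * (v \<bullet>c y)" using y assms(3) by (simp add: ev conjugate_smult_vec e)
  finally show False using yy by simp
qed

lemma jordan_matrix_singleton_blocks:
  "jordan_matrix (map (Pair 1) es) =
    mat (length es) (length es) (\<lambda>(i, j). if i = j then es ! i else 0)"
proof (induction es)
  case Nil
  show ?case by (simp add: jordan_matrix_def) (auto intro!: eq_matI)
next
  case (Cons e es)
  then show ?case
    by (intro eq_matI) (auto simp: jordan_matrix_def Let_def nth_Cons' jordan_block_def)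
qed

text \<open>The characteristic polynomial splits over the complex numbers, so a Jordan form exists,
  and all its blocks turn out to have size 1. \<open>P\<close> and \<open>Q\<close> are merely
  inverse to each other; unitarity is not recorded.\<close>

lemma hermitian_similar_diagonal:
  assumes "hermitian A" "A \<in> carrier_mat n n"
  obtains d P Q where "similar_mat_wit A (mat n n (\<lambda>(i, j). if i = j then d i else 0)) P Q"
    "\<And>i. i < n \<Longrightarrow> d i \<in> spectrum A"
proof -
  obtain as where "char_poly A = (\<Prod>a\<leftarrow>as. [:- a, 1:])"
    using char_poly_factorized[OF assms(2)] by blast
  then obtain n_as where jnf: "jordan_nf A n_as"
    using jordan_nf_exists[OF assms(2)] by blast
  have one: "m = 1" if "(m, e) \<in> set n_as" for m e
  proof -
    have cA: "char_matrix A e \<in> carrier_mat n n" using assms(2) by simp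
    have "mat_kernel (char_matrix A e ^\<^sub>m 2) = mat_kernel (char_matrix A e ^\<^sub>m 1)"
      using cA hermitian_generalized_eigenvector[OF assms]
      by (auto simp: mat_kernel[of _ n n] numeral_2_eq_2)
    then have "dim_gen_eigenspace A e 2 = dim_gen_eigenspace A e 1"
      using assms(2) by (simp add: dim_gen_eigenspace_def kernel_dim_def)
    \<comment> \<open>A block of size \<open>m\<close> for \<open>e\<close> contributes
      \<open>min j m\<close> to the dimension of the kernel of the \<open>j\<close>-th power of A -
      e I.\<close>
    then have eq: "(\<Sum>m\<leftarrow>map fst [(m, b)\<leftarrow>n_as. b = e]. min 2 m) =
        (\<Sum>m\<leftarrow>map fst [(m, b)\<leftarrow>n_as. b = e]. min 1 m)"
      unfolding dim_gen_eigenspace[OF jnf] .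
    \<comment> \<open>The summands are ordered termwise, so equal sums force equal summands;
      \<open>min 2 m = min 1 m\<close> then leaves only sizes 0 and 1.\<close>
    have "\<forall>m\<in>set ms. min 2 m = min 1 m"
      if "(\<Sum>m\<leftarrow>ms. min 2 m) = (\<Sum>m\<leftarrow>ms. min 1 (m::nat))" for ms
      using that
    proof (induction ms)
      case (Cons m ms)
      have "(\<Sum>m\<leftarrow>ms. min 1 m) \<le> (\<Sum>m\<leftarrow>ms. min 2 m)" by (intro sum_list_mono) auto
      with Cons show ?case by (auto simp: min_def split: if_splits)
    qed simp
    from this[OF eq] have "min 2 m = min 1 m" using that by force
    moreover have "m \<noteq> 0" using jnf that by (force simp: jordan_nf_def)
    ultimately show ?thesis by (auto simp: min_def split: if_splits)
  qed
  define es where "es = map snd n_as"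
  have n_as: "n_as = map (Pair 1) es"
    unfolding es_def map_map by (rule sym, rule map_idI) (use one in auto)
  let ?J = "mat (length es) (length es) (\<lambda>(i, j). if i = j then es ! i else 0)"
  obtain P Q where wit: "similar_mat_wit A ?J P Q"
    using jnf unfolding jordan_nf_def similar_mat_def n_as jordan_matrix_singleton_blocks by blast
  have len: "length es = n"
    using similar_mat_witD2[OF assms(2) wit] by auto
  \<comment> \<open>The diagonal entries are the roots of the characteristic polynomial, hence
    eigenvalues.\<close>
  have "char_poly A = (\<Prod>a\<leftarrow>es. [:- a, 1:])"
    using jordan_nf_powE[OF assms(2) jnf] by (auto simp: n_as o_def)
  then have "es ! i \<in> spectrum A" if "i < n" for i
    using that len nth_mem[of i es] unfolding spectrum_root_char_poly[OF assms(2)]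
    by (auto simp: poly_prod_list prod_list_zero_iff o_def)
  then show ?thesis using that[of "(!) es" P Q] wit len by simp
qed

section \<open>Finite sums of matrices\<close>

text \<open>The type \<open>complex mat\<close> does not fix a dimension, so \<open>n\<close> is an
  explicit argument; the empty sum is the zero matrix of that size.\<close>

definition mat_sum :: "nat \<Rightarrow> ('b \<Rightarrow> complex mat) \<Rightarrow> 'b set \<Rightarrow> complex mat" where
  "mat_sum n f S = mat n n (\<lambda>ij. \<Sum>x\<in>S. f x $$ ij)"

lemma mat_sum_carrier [simp]: "mat_sum n f S \<in> carrier_mat n n"
  by (simp add: mat_sum_def)

lemma mat_sum_index [simp]:
  "i < n \<Longrightarrow> j < n \<Longrightarrow> mat_sum n f S $$ (i, j) = (\<Sum>x\<in>S. f x $$ (i, j))"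
  by (simp add: mat_sum_def)

lemma mat_sum_dim [simp]: "dim_row (mat_sum n f S) = n" "dim_col (mat_sum n f S) = n"
  by (simp_all add: mat_sum_def)

lemma mat_sum_cong:
  "(\<And>x. x \<in> S \<Longrightarrow> f x = g x) \<Longrightarrow> mat_sum n f S = mat_sum n g S"
  by (simp add: mat_sum_def)

lemma linear_mat_map_mat_sum:
  assumes "linear_mat_map n k \<Phi>" "finite S" "\<And>x. x \<in> S \<Longrightarrow> f x \<in> carrier_mat n n"
  shows "\<Phi> (mat_sum n f S) = mat_sum k (\<lambda>x. \<Phi> (f x)) S"
proof -
  note lin = assms(1)[unfolded linear_mat_map_def]
  have carrier: "\<Phi> X \<in> carrier_mat k k" if "X \<in> carrier_mat n n" for X
    using lin that by blast
  from assms(2,3) show ?thesis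
  proof (induction S rule: finite_induct)
    case empty
    \<comment> \<open>Writing the zero matrix as 0 times itself lets homogeneity give the value of
      \<open>\<Phi>\<close> on the empty sum.\<close>
    have "\<Phi> (mat_sum n f {}) = \<Phi> (0 \<cdot>\<^sub>m 0\<^sub>m n n)"
      by (rule arg_cong[of _ _ \<Phi>], rule eq_matI) auto
    also have "\<dots> = 0 \<cdot>\<^sub>m \<Phi> (0\<^sub>m n n)" using lin zero_carrier_mat by blast
    also have "\<dots> = mat_sum k (\<lambda>x. \<Phi> (f x)) {}"
      using carrier[of "0\<^sub>m n n"] by (intro eq_matI) auto
    finally show ?case .
  next
    case (insert x S)
    have "mat_sum n f (insert x S) = f x + mat_sum n f S"
      using insert by (intro eq_matI) auto
    then have "\<Phi> (mat_sum n f (insert x S)) = \<Phi> (f x) + mat_sum k (\<lambda>x. \<Phi> (f x)) S"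
      using lin insert by simp
    also have "\<dots> = mat_sum k (\<lambda>x. \<Phi> (f x)) (insert x S)"
      using insert carrier[of "f x"] by (intro eq_matI) auto
    finally show ?case .
  qed
qed

lemma mult_mat_sum:
  assumes "A \<in> carrier_mat n n" "\<And>x. x \<in> S \<Longrightarrow> f x \<in> carrier_mat n n"
  shows "A * mat_sum n f S = mat_sum n (\<lambda>x. A * f x) S"
proof (rule eq_matI)
  fix i j assume "i < dim_row (mat_sum n (\<lambda>x. A * f x) S)" "j < dim_col (mat_sum n (\<lambda>x. A * f x) S)"
  then have ij: "i < n" "j < n" by simp_all
  have "(A * mat_sum n f S) $$ (i, j) = (\<Sum>l<n. \<Sum>x\<in>S. A $$ (i, l) * f x $$ (l, j))"
    using assms(1) ij by (simp add: scalar_prod_def sum_distrib_left atLeast0LessThan)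
  also have "\<dots> = (\<Sum>x\<in>S. \<Sum>l<n. A $$ (i, l) * f x $$ (l, j))" by (rule sum.swap)
  also have "\<dots> = mat_sum n (\<lambda>x. A * f x) S $$ (i, j)"
  proof -
    have "(\<Sum>l<n. A $$ (i, l) * f x $$ (l, j)) = (A * f x) $$ (i, j)" if "x \<in> S" for x
      using assms(1) assms(2)[OF that] ij by (simp add: scalar_prod_def atLeast0LessThan)
    then show ?thesis using ij by simp
  qed
  finally show "(A * mat_sum n f S) $$ (i, j) = mat_sum n (\<lambda>x. A * f x) S $$ (i, j)" .
qed (use assms in auto)

lemma mat_sum_mult:
  assumes "A \<in> carrier_mat n n" "\<And>x. x \<in> S \<Longrightarrow> f x \<in> carrier_mat n n"
  shows "mat_sum n f S * A = mat_sum n (\<lambda>x. f x * A) S"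
proof (rule eq_matI)
  fix i j assume "i < dim_row (mat_sum n (\<lambda>x. f x * A) S)" "j < dim_col (mat_sum n (\<lambda>x. f x * A) S)"
  then have ij: "i < n" "j < n" by simp_all
  have "(mat_sum n f S * A) $$ (i, j) = (\<Sum>l<n. \<Sum>x\<in>S. f x $$ (i, l) * A $$ (l, j))"
    using assms(1) ij by (simp add: scalar_prod_def sum_distrib_right atLeast0LessThan)
  also have "\<dots> = (\<Sum>x\<in>S. \<Sum>l<n. f x $$ (i, l) * A $$ (l, j))" by (rule sum.swap)
  also have "\<dots> = mat_sum n (\<lambda>x. f x * A) S $$ (i, j)"
  proof -
    have "(\<Sum>l<n. f x $$ (i, l) * A $$ (l, j)) = (f x * A) $$ (i, j)" if "x \<in> S" for x
      using assms(1) assms(2)[OF that] ij by (simp add: scalar_prod_def atLeast0LessThan)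
    then show ?thesis using ij by simp
  qed
  finally show "(mat_sum n f S * A) $$ (i, j) = mat_sum n (\<lambda>x. f x * A) S $$ (i, j)" .
qed (use assms in auto)

lemma psd_mat_sum:
  assumes "\<And>x. x \<in> S \<Longrightarrow> f x \<in> carrier_mat n n" "\<And>x. x \<in> S \<Longrightarrow> psd (f x)"
  shows "psd (mat_sum n f S)"
proof -
  have herm: "f x $$ (j, i) = cnj (f x $$ (i, j))" if "x \<in> S" "i < n" "j < n" for x i j
    using assms(2)[OF that(1)] that(2,3) unfolding psd_iff_sum[OF assms(1)[OF that(1)]] by blast
  have nonneg: "0 \<le> (\<Sum>i<n. \<Sum>j<n. f x $$ (i, j) * v j * cnj (v i))" if "x \<in> S" for x v
    using assms(2)[OF that] unfolding psd_iff_sum[OF assms(1)[OF that]] by blast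
  have "0 \<le> (\<Sum>i<n. \<Sum>j<n. mat_sum n f S $$ (i, j) * v j * cnj (v i))" for v
  proof -
    have "(\<Sum>i<n. \<Sum>j<n. mat_sum n f S $$ (i, j) * v j * cnj (v i)) =
        (\<Sum>i<n. \<Sum>x\<in>S. \<Sum>j<n. f x $$ (i, j) * v j * cnj (v i))"
      by (intro sum.cong refl) (simp add: sum_distrib_right, rule sum.swap)
    also have "\<dots> = (\<Sum>x\<in>S. \<Sum>i<n. \<Sum>j<n. f x $$ (i, j) * v j * cnj (v i))"
      by (rule sum.swap)
    also have "\<dots> \<ge> 0" by (intro sum_nonneg nonneg)
    finally show ?thesis .
  qed
  moreover have "mat_sum n f S $$ (j, i) = cnj (mat_sum n f S $$ (i, j))" if "i < n" "j < n" for i j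
    unfolding mat_sum_index[OF that] mat_sum_index[OF that(2,1)] cnj_sum
    using that by (intro sum.cong refl herm)
  ultimately show ?thesis unfolding psd_iff_sum[OF mat_sum_carrier] by blast
qed

text \<open>Congruence of \<open>B\<close> by the matrix whose column \<open>a\<close> is \<open>d a\<close> times the unit vector \<open>h a\<close>.\<close>

lemma psd_weighted_reindex:
  assumes "psd B" "B \<in> carrier_mat k k" "\<And>a. a < N \<Longrightarrow> h a < k"
  shows "psd (mat N N (\<lambda>(a, b). cnj (d a) * d b * B $$ (h a, h b)))" (is "psd ?C")
proof -
  have C: "?C \<in> carrier_mat N N" by simp
  have B: "\<And>i j. i < k \<Longrightarrow> j < k \<Longrightarrow> B $$ (j, i) = cnj (B $$ (i, j))"
    "\<And>v. 0 \<le> (\<Sum>i<k. \<Sum>j<k. B $$ (i, j) * v j * cnj (v i))"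
    using assms(1) unfolding psd_iff_sum[OF assms(2)] by blast+
  have "0 \<le> (\<Sum>a<N. \<Sum>b<N. ?C $$ (a, b) * v b * cnj (v a))" for v
  proof -
    \<comment> \<open>\<open>w\<close> is the image of \<open>v\<close> under the congruence matrix,
      so the form of \<open>?C\<close> at \<open>v\<close> is the form of \<open>B\<close> at
      \<open>w\<close>.\<close>
    define w where "w i = (\<Sum>a | a \<in> {..<N} \<and> h a = i. d a * v a)" for i
    \<comment> \<open>The fibres of \<open>h\<close> partition the indices below \<open>N\<close>.
      This is applied twice, once for each occurrence of \<open>w\<close>.\<close>
    have fib: "(\<Sum>i<k. \<Sum>a | a \<in> {..<N} \<and> h a = i. g a) = (\<Sum>a<N. g a)" for g :: "nat \<Rightarrow> complex"
      using assms(3) by (intro sum.group) auto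
    have "(\<Sum>i<k. \<Sum>j<k. B $$ (i, j) * w j * cnj (w i)) =
        (\<Sum>i<k. \<Sum>a | a \<in> {..<N} \<and> h a = i. \<Sum>j<k. B $$ (i, j) * w j * cnj (d a * v a))"
      unfolding w_def[of i for i] cnj_sum sum_distrib_left by (intro sum.cong refl sum.swap)
    also have "\<dots> = (\<Sum>i<k. \<Sum>a | a \<in> {..<N} \<and> h a = i. \<Sum>j<k. B $$ (h a, j) * w j * cnj (d a * v a))"
      by (intro sum.cong refl) auto
    also have "\<dots> = (\<Sum>a<N. \<Sum>j<k. B $$ (h a, j) * w j * cnj (d a * v a))"
      by (rule fib)
    also have "\<dots> = (\<Sum>a<N. \<Sum>j<k. \<Sum>b | b \<in> {..<N} \<and> h b = j. B $$ (h a, h b) * (d b * v b) * cnj (d a * v a))"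
      unfolding w_def sum_distrib_left sum_distrib_right by (intro sum.cong refl) auto
    also have "\<dots> = (\<Sum>a<N. \<Sum>b<N. B $$ (h a, h b) * (d b * v b) * cnj (d a * v a))"
      unfolding fib ..
    also have "\<dots> = (\<Sum>a<N. \<Sum>b<N. ?C $$ (a, b) * v b * cnj (v a))"
      by (intro sum.cong refl) (simp add: mult_ac)
    finally show ?thesis using B(2)[of w] by simp
  qed
  moreover have "?C $$ (b, a) = cnj (?C $$ (a, b))" if "a < N" "b < N" for a b
    using that B(1)[OF assms(3)[of a] assms(3)[of b]] by (simp add: mult_ac)
  ultimately show ?thesis unfolding psd_iff_sum[OF C] by blast
qed

section \<open>Spectral projections and their positivity\<close>

text \<open>Coordinate projections for the diagonal form are carried over to \<open>A\<close> by
  conjugation. The two properties recorded here, eigenvector columns and summing to the identity,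
  suffice to derive positivity afterwards.\<close>

lemma hermitian_spectral_resolution:
  assumes "hermitian A" "A \<in> carrier_mat n n"
  obtains E where "\<And>\<mu>. E \<mu> \<in> carrier_mat n n" "\<And>\<mu>. A * E \<mu> = \<mu> \<cdot>\<^sub>m E \<mu>"
    "mat_sum n E (spectrum A) = 1\<^sub>m n"
proof -
  obtain d P Q where "similar_mat_wit A (mat n n (\<lambda>(i, j). if i = j then d i else 0)) P Q"
    and d: "\<And>i. i < n \<Longrightarrow> d i \<in> spectrum A"
    by (rule hermitian_similar_diagonal[OF assms]) blast
  then have wit: "similar_mat_wit A (mat n n (\<lambda>(i, j). if i = j then d i else 0)) P Q"
    (is "similar_mat_wit A ?J P Q") by simp
  note w = similar_mat_witD2[OF assms(2) wit]
  \<comment> \<open>\<open>F \<mu>\<close> projects onto the coordinates with diagonal entry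
    \<open>\<mu>\<close>; it vanishes when \<open>\<mu>\<close> is not an eigenvalue.\<close>
  define F where "F \<mu> = mat n n (\<lambda>(i, j). if i = j \<and> d i = \<mu> then 1 else 0 :: complex)" for \<mu>
  have F: "F \<mu> \<in> carrier_mat n n" for \<mu> by (simp add: F_def)
  have JF: "?J * F \<mu> = \<mu> \<cdot>\<^sub>m F \<mu>" for \<mu>
  proof (rule eq_matI)
    fix i j assume "i < dim_row (\<mu> \<cdot>\<^sub>m F \<mu>)" "j < dim_col (\<mu> \<cdot>\<^sub>m F \<mu>)"
    then have ij: "i < n" "j < n" using F[of \<mu>] by auto
    have "(?J * F \<mu>) $$ (i, j) = (\<Sum>l<n. (if i = l then d i else 0) * F \<mu> $$ (l, j))"
      using ij F[of \<mu>] by (simp add: scalar_prod_def atLeast0LessThan)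
    also have "\<dots> = (\<Sum>l<n. if l = i then d i * F \<mu> $$ (l, j) else 0)"
      by (intro sum.cong) auto
    also have "\<dots> = (\<mu> \<cdot>\<^sub>m F \<mu>) $$ (i, j)" using ij by (auto simp: F_def)
    finally show "(?J * F \<mu>) $$ (i, j) = (\<mu> \<cdot>\<^sub>m F \<mu>) $$ (i, j)" .
  qed (simp_all add: F_def)
  define E where "E \<mu> = P * F \<mu> * Q" for \<mu>
  have E: "E \<mu> \<in> carrier_mat n n" for \<mu>
    using w(6,7) F unfolding E_def by (intro mult_carrier_mat[of _ n n])
  have AE: "A * E \<mu> = \<mu> \<cdot>\<^sub>m E \<mu>" for \<mu>
  proof -
    have "A * E \<mu> = P * ?J * (Q * P) * F \<mu> * Q"
      unfolding E_def w(3) using w(5-7) F[of \<mu>]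
      by (simp add: assoc_mult_mat[of _ n n _ n _ n] mult_carrier_mat[of _ n n _ n])
    also have "\<dots> = P * (?J * F \<mu>) * Q"
      using w(5-7) F[of \<mu>] unfolding w(2)
      by (simp add: assoc_mult_mat[of _ n n _ n _ n] mult_carrier_mat[of _ n n _ n])
    also have "\<dots> = \<mu> \<cdot>\<^sub>m E \<mu>"
      unfolding JF E_def using w(5-7) F[of \<mu>]
      by (simp add: mult_smult_distrib[of _ n n _ n] mult_smult_assoc_mat[of _ n n _ n] mult_carrier_mat[of _ n n _ n])
    finally show ?thesis .
  qed
  have fin: "finite (spectrum A)" using card_finite_spectrum[OF assms(2)] by simp
  \<comment> \<open>Position \<open>i\<close> on the diagonal receives exactly one 1, from
    \<open>\<mu> = d i\<close>, which lies in the spectrum.\<close>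
  have "mat_sum n F (spectrum A) = 1\<^sub>m n"
  proof (rule eq_matI)
    fix i j assume "i < dim_row (1\<^sub>m n :: complex mat)" "j < dim_col (1\<^sub>m n :: complex mat)"
    then show "mat_sum n F (spectrum A) $$ (i, j) = 1\<^sub>m n $$ (i, j)"
      using d[of i] fin by (cases "i = j") (simp_all add: F_def)
  qed simp_all
  then have "mat_sum n E (spectrum A) = 1\<^sub>m n"
    using w(1,6,7) F unfolding E_def
    by (simp add: mat_sum_mult[symmetric] mult_mat_sum[symmetric] mult_carrier_mat[of _ n n _ n])
  with E AE show ?thesis using that by blast
qed

text \<open>The ranges of the \<open>E \<nu>\<close> lie in eigenspaces of a Hermitian matrix and so
  are mutually orthogonal. As the \<open>E \<nu>\<close> sum to the identity, <E v, w> = <E v, E w>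
  for E = \<open>E \<mu>\<close>, a form that is visibly Hermitian and nonnegative.\<close>

lemma hermitian_eigenprojection_psd:
  assumes A: "hermitian A" "A \<in> carrier_mat n n"
    and E: "\<And>\<mu>. E \<mu> \<in> carrier_mat n n" "\<And>\<mu>. A * E \<mu> = \<mu> \<cdot>\<^sub>m E \<mu>"
    and one: "mat_sum n E (spectrum A) = 1\<^sub>m n"
    and \<mu>: "\<mu> \<in> spectrum A"
  shows "psd (E \<mu>)"
proof -
  have fin: "finite (spectrum A)" using card_finite_spectrum[OF A(2)] by simp
  have Ev: "E \<nu> *\<^sub>v v \<in> carrier_vec n" if "v \<in> carrier_vec n" for \<nu> v
    using E(1) that by (rule mult_mat_vec_carrier)
  have eigen: "A *\<^sub>v (E \<nu> *\<^sub>v v) = \<nu> \<cdot>\<^sub>v (E \<nu> *\<^sub>v v)" if "v \<in> carrier_vec n" for \<nu> v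
  proof -
    have "A *\<^sub>v (E \<nu> *\<^sub>v v) = (\<nu> \<cdot>\<^sub>m E \<nu>) *\<^sub>v v"
      using E(1) A(2) that by (simp add: assoc_mult_mat_vec[symmetric, of _ n n _ n] E(2))
    also have "\<dots> = \<nu> \<cdot>\<^sub>v (E \<nu> *\<^sub>v v)"
      using E(1)[of \<nu>] that by (intro eq_vecI) auto
    finally show ?thesis .
  qed
  \<comment> \<open>Membership in the spectrum is required of \<open>\<kappa>\<close> because its
    reality is what removes the conjugate.\<close>
  have orth: "(E \<nu> *\<^sub>v v) \<bullet>c (E \<kappa> *\<^sub>v w) = 0"
    if "\<nu> \<noteq> \<kappa>" "\<kappa> \<in> spectrum A" "v \<in> carrier_vec n" "w \<in> carrier_vec n" for \<nu> \<kappa> v w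
  proof -
    note vw = Ev[OF that(3), of \<nu>] Ev[OF that(4), of \<kappa>]
    have "\<nu> * ((E \<nu> *\<^sub>v v) \<bullet>c (E \<kappa> *\<^sub>v w)) = (A *\<^sub>v (E \<nu> *\<^sub>v v)) \<bullet>c (E \<kappa> *\<^sub>v w)"
      using vw by (simp add: eigen[OF that(3)])
    also have "\<dots> = (E \<nu> *\<^sub>v v) \<bullet>c (A *\<^sub>v (E \<kappa> *\<^sub>v w))"
      by (rule hermitian_cscalar_prod_swap[OF A vw])
    also have "\<dots> = \<kappa> * ((E \<nu> *\<^sub>v v) \<bullet>c (E \<kappa> *\<^sub>v w))"
      using vw hermitian_spectrum_real[OF A that(2)]
      by (simp add: eigen[OF that(4)] conjugate_smult_vec)
    finally show ?thesis using that(1) by simp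
  qed
  \<comment> \<open>The resolution of the identity is applied to the second argument.\<close>
  have expand: "v \<bullet>c w = (\<Sum>\<nu>\<in>spectrum A. v \<bullet>c (E \<nu> *\<^sub>v w))"
    if "v \<in> carrier_vec n" "w \<in> carrier_vec n" for v w
  proof -
    have "w = vec n (\<lambda>i. \<Sum>\<nu>\<in>spectrum A. (E \<nu> *\<^sub>v w) $ i)"
    proof (rule eq_vecI)
      fix i assume "i < dim_vec (vec n (\<lambda>i. \<Sum>\<nu>\<in>spectrum A. (E \<nu> *\<^sub>v w) $ i))"
      then have i: "i < n" by simp
      have "w $ i = (mat_sum n E (spectrum A) *\<^sub>v w) $ i" using that by (simp add: one)
      also have "\<dots> = (\<Sum>l<n. \<Sum>\<nu>\<in>spectrum A. E \<nu> $$ (i, l) * w $ l)"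
        using that i by (simp add: scalar_prod_def atLeast0LessThan sum_distrib_right)
      also have "\<dots> = (\<Sum>\<nu>\<in>spectrum A. \<Sum>l<n. E \<nu> $$ (i, l) * w $ l)" by (rule sum.swap)
      also have "\<dots> = (\<Sum>\<nu>\<in>spectrum A. (E \<nu> *\<^sub>v w) $ i)"
      proof (rule sum.cong[OF refl])
        fix \<nu>
        show "(\<Sum>l<n. E \<nu> $$ (i, l) * w $ l) = (E \<nu> *\<^sub>v w) $ i"
          using that i E(1)[of \<nu>] by (simp add: scalar_prod_def atLeast0LessThan)
      qed
      finally show "w $ i = vec n (\<lambda>i. \<Sum>\<nu>\<in>spectrum A. (E \<nu> *\<^sub>v w) $ i) $ i" using i by simp
    qed (use that in simp)
    then have "v \<bullet>c w = v \<bullet>c vec n (\<lambda>i. \<Sum>\<nu>\<in>spectrum A. (E \<nu> *\<^sub>v w) $ i)" by simp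
    also have "\<dots> = (\<Sum>i<n. \<Sum>\<nu>\<in>spectrum A. v $ i * cnj ((E \<nu> *\<^sub>v w) $ i))"
      by (simp add: scalar_prod_def[of v] atLeast0LessThan sum_distrib_left)
    also have "\<dots> = (\<Sum>\<nu>\<in>spectrum A. \<Sum>i<n. v $ i * cnj ((E \<nu> *\<^sub>v w) $ i))" by (rule sum.swap)
    also have "\<dots> = (\<Sum>\<nu>\<in>spectrum A. v \<bullet>c (E \<nu> *\<^sub>v w))"
    proof (rule sum.cong[OF refl])
      fix \<nu>
      show "(\<Sum>i<n. v $ i * cnj ((E \<nu> *\<^sub>v w) $ i)) = v \<bullet>c (E \<nu> *\<^sub>v w)"
        using E(1)[of \<nu>] by (simp add: scalar_prod_def[of v] atLeast0LessThan)
    qed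
    finally show ?thesis .
  qed
  have proj: "(E \<mu> *\<^sub>v v) \<bullet>c w = (E \<mu> *\<^sub>v v) \<bullet>c (E \<mu> *\<^sub>v w)"
    if "v \<in> carrier_vec n" "w \<in> carrier_vec n" for v w :: "complex vec"
  proof -
    have "(E \<mu> *\<^sub>v v) \<bullet>c w = (\<Sum>\<nu>\<in>spectrum A. (E \<mu> *\<^sub>v v) \<bullet>c (E \<nu> *\<^sub>v w))"
      by (rule expand[OF Ev[OF that(1)] that(2)])
    also have "\<dots> = (\<Sum>\<nu>\<in>spectrum A. if \<nu> = \<mu> then (E \<mu> *\<^sub>v v) \<bullet>c (E \<mu> *\<^sub>v w) else 0)"
      using that orth by (intro sum.cong) auto
    finally show ?thesis using \<mu> fin by simp
  qed
  \<comment> \<open>Evaluating \<open>proj\<close> at unit vectors writes the entries as inner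
    products of columns of \<open>E \<mu>\<close>, which are conjugate symmetric.\<close>
  have herm: "E \<mu> $$ (j, i) = cnj (E \<mu> $$ (i, j))" if ij: "i < n" "j < n" for i j
  proof -
    have entry: "(E \<mu> *\<^sub>v unit_vec n b) \<bullet>c unit_vec n a = E \<mu> $$ (a, b)" if "a < n" "b < n" for a b
    proof -
      have "conjugate (unit_vec n a) = (unit_vec n a :: complex vec)"
        by (intro eq_vecI) (auto simp: unit_vec_def)
      then show ?thesis using that E(1)[of \<mu>] by simp
    qed
    let ?x = "E \<mu> *\<^sub>v unit_vec n i" and ?y = "E \<mu> *\<^sub>v unit_vec n j"
    have xy: "?x \<in> carrier_vec n" "?y \<in> carrier_vec n" using Ev by simp_all
    have "E \<mu> $$ (j, i) = ?x \<bullet>c ?y"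
      using proj[of "unit_vec n i" "unit_vec n j"] entry[OF ij(2,1)] by simp
    also have "\<dots> = cnj (?y \<bullet>c ?x)"
      using conjugate_conjugate_sprod[OF xy] conjugate_vec_sprod_comm[OF xy(2,1)] by simp
    also have "?y \<bullet>c ?x = E \<mu> $$ (i, j)"
      using proj[of "unit_vec n j" "unit_vec n i"] entry[OF ij] by simp
    finally show ?thesis .
  qed
  show ?thesis
    unfolding psd_def
  proof (intro conjI ballI)
    show "hermitian (E \<mu>)" by (rule hermitianI[OF E(1) herm])
  next
    fix v :: "complex vec" assume "v \<in> carrier_vec (dim_row (E \<mu>))"
    then have v: "v \<in> carrier_vec n" using E(1)[of \<mu>] by simp
    show "0 \<le> (E \<mu> *\<^sub>v v) \<bullet>c v"
      unfolding proj[OF v v] by (rule conjugate_square_ge_0_vec)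
  qed
qed

section \<open>Polynomials in \<open>A\<close> acting on a spectral projection\<close>

text \<open>The columns of \<open>E\<close> are killed by A - \<open>\<mu>\<close> I, so each
  factor, applied from the right end inwards, acts on \<open>E\<close> as a scalar.\<close>

lemma eigenprojection_poly:
  fixes A :: "complex mat"
  assumes A: "A \<in> carrier_mat n n" and E: "E \<in> carrier_mat n n" "A * E = \<mu> \<cdot>\<^sub>m E"
  shows "A ^\<^sub>m m * (A - a \<cdot>\<^sub>m 1\<^sub>m n) * (A - b \<cdot>\<^sub>m 1\<^sub>m n) * E = (\<mu> ^ m * (\<mu> - a) * (\<mu> - b)) \<cdot>\<^sub>m E"
proof -
  have cm: "A - c \<cdot>\<^sub>m 1\<^sub>m n \<in> carrier_mat n n" for c
    by (intro minus_carrier_mat smult_carrier_mat one_carrier_mat)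
  \<comment> \<open>The scalar \<open>t\<close> accumulates the contributions of the factors already
    applied.\<close>
  have lin: "(A - c \<cdot>\<^sub>m 1\<^sub>m n) * (t \<cdot>\<^sub>m E) = (t * (\<mu> - c)) \<cdot>\<^sub>m E" for c t
  proof -
    have "(A - c \<cdot>\<^sub>m 1\<^sub>m n) * (t \<cdot>\<^sub>m E) = t \<cdot>\<^sub>m ((A - c \<cdot>\<^sub>m 1\<^sub>m n) * E)"
      using A E(1) by (intro mult_smult_distrib[of _ n n]) auto
    also have "(A - c \<cdot>\<^sub>m 1\<^sub>m n) * E = A * E - (c \<cdot>\<^sub>m 1\<^sub>m n) * E"
      using A E(1) by (intro minus_mult_distrib_mat[of _ n n]) auto
    also have "(c \<cdot>\<^sub>m 1\<^sub>m n) * E = c \<cdot>\<^sub>m E"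
      using E(1) by (simp add: mult_smult_assoc_mat[of _ n n _ n])
    also have "t \<cdot>\<^sub>m (A * E - c \<cdot>\<^sub>m E) = (t * (\<mu> - c)) \<cdot>\<^sub>m E"
      unfolding E(2) using E(1) by (intro eq_matI) (auto simp: algebra_simps)
    finally show ?thesis .
  qed
  have pow: "A ^\<^sub>m m * (t \<cdot>\<^sub>m E) = (\<mu> ^ m * t) \<cdot>\<^sub>m E" for t
  proof (induction m arbitrary: t)
    case 0
    show ?case using A E(1) by simp
  next
    case (Suc m)
    have "A ^\<^sub>m Suc m * (t \<cdot>\<^sub>m E) = A ^\<^sub>m m * (A * (t \<cdot>\<^sub>m E))"
      using A E(1) by (simp add: assoc_mult_mat[of _ n n _ n _ n])
    also have "A * (t \<cdot>\<^sub>m E) = (t * \<mu>) \<cdot>\<^sub>m E"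
      using A E(1) by (simp add: mult_smult_distrib[of _ n n _ n] E(2)) (auto intro!: eq_matI)
    finally show ?case by (simp add: Suc mult_ac)
  qed
  \<comment> \<open>\<open>E\<close> is written as \<open>1 \<cdot>\<^sub>m E\<close> so that
    \<open>lin\<close> already fits the innermost factor.\<close>
  have "A ^\<^sub>m m * (A - a \<cdot>\<^sub>m 1\<^sub>m n) * (A - b \<cdot>\<^sub>m 1\<^sub>m n) * (1 \<cdot>\<^sub>m E) =
      A ^\<^sub>m m * ((A - a \<cdot>\<^sub>m 1\<^sub>m n) * ((A - b \<cdot>\<^sub>m 1\<^sub>m n) * (1 \<cdot>\<^sub>m E)))"
    using A E(1) cm by (simp add: assoc_mult_mat[of _ n n _ n _ n] mult_carrier_mat[of _ n n _ n])
  moreover have "1 \<cdot>\<^sub>m E = E" by (intro eq_matI) auto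
  ultimately show ?thesis using lin[of _ 1] by (simp add: lin pow mult_ac)
qed

section \<open>Decomposition of the block matrix over the spectrum\<close>

theorem theorem2p4:
  fixes n k p :: nat
    and \<Phi> :: "complex mat \<Rightarrow> complex mat"
    and A :: "complex mat"
    and lam :: "nat \<Rightarrow> real"
  assumes "linear_mat_map n k \<Phi>"
    and "positive_mat_map n \<Phi>"
    and "unital_mat_map n k \<Phi>"
    and "A \<in> carrier_mat n n"
    and "hermitian A"
    and "strict_mono_on {1..p} lam"
    and "spectrum A = (\<lambda>i. complex_of_real (lam i)) ` {1..p}"
  shows "\<forall>l \<in> {2..p}. \<forall>r::nat.
    psd (block_matrix (r + 1) k (\<lambda>i j.
      \<Phi> (A ^\<^sub>m (i + j - 2)
           * (A - complex_of_real (lam (l - 1)) \<cdot>\<^sub>m 1\<^sub>m n)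
           * (A - complex_of_real (lam l) \<cdot>\<^sub>m 1\<^sub>m n))))"
proof (intro ballI allI)
  fix l r assume l: "l \<in> {2..p}"
  let ?S = "spectrum A" and ?a = "lam (l - 1)" and ?b = "lam l" and ?N = "(r + 1) * k"
  let ?M = "\<lambda>m. A ^\<^sub>m m * (A - complex_of_real ?a \<cdot>\<^sub>m 1\<^sub>m n) * (A - complex_of_real ?b \<cdot>\<^sub>m 1\<^sub>m n)"
  obtain E where E: "\<And>\<mu>. E \<mu> \<in> carrier_mat n n" "\<And>\<mu>. A * E \<mu> = \<mu> \<cdot>\<^sub>m E \<mu>"
    and one: "mat_sum n E ?S = 1\<^sub>m n"
    using hermitian_spectral_resolution[OF assms(5,4)] by blast
  have fin: "finite ?S" by (simp add: assms(7))
  have \<Phi>E: "\<Phi> (E \<mu>) \<in> carrier_mat k k" for \<mu>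
    using assms(1) E(1) by (auto simp: linear_mat_map_def)
  have \<Phi>psd: "psd (\<Phi> (E \<mu>))" if "\<mu> \<in> ?S" for \<mu>
    using hermitian_eigenprojection_psd[OF assms(5,4) E one that] assms(2) E(1)
    by (auto simp: positive_mat_map_def)
  \<comment> \<open>Real parts make \<open>c\<close> real-valued, so that it has a sign and a real
    square root; on the spectrum nothing is lost.\<close>
  define c where "c \<mu> = (Re \<mu> - ?a) * (Re \<mu> - ?b)" for \<mu>
  have real: "complex_of_real (Re \<mu>) = \<mu>" if "\<mu> \<in> ?S" for \<mu>
    using that by (auto simp: assms(7))
  have c: "0 \<le> c \<mu>" if "\<mu> \<in> ?S" for \<mu>
  proof -
    obtain i where i: "i \<in> {1..p}" "\<mu> = complex_of_real (lam i)"
      using \<open>\<mu> \<in> ?S\<close> by (auto simp: assms(7))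
    have mono: "lam x \<le> lam y" if "x \<le> y" "x \<in> {1..p}" "y \<in> {1..p}" for x y
      using strict_mono_onD[OF assms(6) that(2,3)] that(1) by (cases "x = y") auto
    \<comment> \<open>No index lies strictly between \<open>l - 1\<close> and \<open>l\<close>, so
      both factors of \<open>c \<mu>\<close> have the same sign.\<close>
    consider "i \<le> l - 1" | "l \<le> i" by linarith
    then show ?thesis
    proof cases
      case 1
      then have "lam i \<le> ?a" "lam i \<le> ?b" using mono i(1) l by auto
      then show ?thesis by (simp add: c_def i(2) mult_nonpos_nonpos)
    next
      case 2
      then have "?a \<le> lam i" "?b \<le> lam i" using mono i(1) l by auto
      then show ?thesis by (simp add: c_def i(2))
    qed
  qed
  have \<Phi>M: "\<Phi> (?M m) = mat_sum k (\<lambda>\<mu>. (\<mu> ^ m * complex_of_real (c \<mu>)) \<cdot>\<^sub>m \<Phi> (E \<mu>)) ?S" for m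
  proof -
    have M: "?M m \<in> carrier_mat n n" 
      using assms(4) by (intro mult_carrier_mat[of _ n n] pow_carrier_mat minus_carrier_mat) simp_all
    \<comment> \<open>Inserting the identity as the sum of the \<open>E \<mu>\<close> turns
      \<open>?M m\<close> into a combination of projections, to which linearity of
      \<open>\<Phi>\<close> applies.\<close>
    have "?M m = ?M m * mat_sum n E ?S" using M by (simp only: one right_mult_one_mat)
    also have "\<dots> = mat_sum n (\<lambda>\<mu>. ?M m * E \<mu>) ?S" by (rule mult_mat_sum[OF M E(1)])
    also have "\<dots> = mat_sum n (\<lambda>\<mu>. (\<mu> ^ m * complex_of_real (c \<mu>)) \<cdot>\<^sub>m E \<mu>) ?S"
      by (intro mat_sum_cong) (simp add: eigenprojection_poly[OF assms(4) E] c_def real mult.assoc)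
    finally have "\<Phi> (?M m) = \<Phi> (mat_sum n (\<lambda>\<mu>. (\<mu> ^ m * complex_of_real (c \<mu>)) \<cdot>\<^sub>m E \<mu>) ?S)"
      by (rule arg_cong)
    also have "\<dots> = mat_sum k (\<lambda>\<mu>. \<Phi> ((\<mu> ^ m * complex_of_real (c \<mu>)) \<cdot>\<^sub>m E \<mu>)) ?S"
      using E(1) by (intro linear_mat_map_mat_sum[OF assms(1) fin]) simp
    also have "\<dots> = mat_sum k (\<lambda>\<mu>. (\<mu> ^ m * complex_of_real (c \<mu>)) \<cdot>\<^sub>m \<Phi> (E \<mu>)) ?S"
      using assms(1) E(1) by (intro mat_sum_cong) (auto simp: linear_mat_map_def)
    finally show ?thesis .
  qed
  \<comment> \<open>Here \<open>x div k\<close> is the block index counted from 0. Splitting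
    \<open>c \<mu>\<close> into two square roots gives each side of the congruence the same
    weight.\<close>
  define d where "d \<mu> x = complex_of_real (sqrt (c \<mu>) * Re \<mu> ^ (x div k))" for \<mu> x
  let ?C = "\<lambda>\<mu>. mat ?N ?N (\<lambda>(x, y). cnj (d \<mu> x) * d \<mu> y * \<Phi> (E \<mu>) $$ (x mod k, y mod k))"
  have "block_matrix (r + 1) k (\<lambda>i j. \<Phi> (?M (i + j - 2))) = mat_sum ?N ?C ?S"
  proof (rule eq_matI)
    fix x y assume "x < dim_row (mat_sum ?N ?C ?S)" "y < dim_col (mat_sum ?N ?C ?S)"
    then have xy: "x < ?N" "y < ?N" by simp_all
    then have "k > 0" by (cases k) auto
    then have md: "x mod k < k" "y mod k < k" by simp_all
    \<comment> \<open>Blocks are counted from 1, so the two added ones cancel the 2 in the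
      exponent.\<close>
    have "block_matrix (r + 1) k (\<lambda>i j. \<Phi> (?M (i + j - 2))) $$ (x, y) =
        \<Phi> (?M (x div k + y div k)) $$ (x mod k, y mod k)"
      using xy by (simp add: block_matrix_def)
    also have "\<dots> = (\<Sum>\<mu>\<in>?S. \<mu> ^ (x div k + y div k) * complex_of_real (c \<mu>) * \<Phi> (E \<mu>) $$ (x mod k, y mod k))"
      unfolding \<Phi>M mat_sum_index[OF md]
    proof (intro sum.cong refl)
      fix \<mu>
      show "(\<mu> ^ (x div k + y div k) * complex_of_real (c \<mu>) \<cdot>\<^sub>m \<Phi> (E \<mu>)) $$ (x mod k, y mod k) =
          \<mu> ^ (x div k + y div k) * complex_of_real (c \<mu>) * \<Phi> (E \<mu>) $$ (x mod k, y mod k)"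
        using md \<Phi>E[of \<mu>] by (intro index_smult_mat(1)) auto
    qed
    also have "\<dots> = (\<Sum>\<mu>\<in>?S. ?C \<mu> $$ (x, y))"
    proof (rule sum.cong[OF refl])
      fix \<mu> assume \<mu>: "\<mu> \<in> ?S"
      have "cnj (d \<mu> x) * d \<mu> y = complex_of_real (sqrt (c \<mu>) * sqrt (c \<mu>) * Re \<mu> ^ (x div k + y div k))"
        unfolding d_def complex_cnj_complex_of_real of_real_mult[symmetric] of_real_eq_iff
        by (simp only: power_add ac_simps)
      \<comment> \<open>Nonnegativity of \<open>c \<mu>\<close> is used here: only then do the
        square roots multiply back to it.\<close>
      also have "\<dots> = \<mu> ^ (x div k + y div k) * complex_of_real (c \<mu>)"
        using c[OF \<mu>] real[OF \<mu>] by (simp add: mult.commute)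
      finally show "\<mu> ^ (x div k + y div k) * complex_of_real (c \<mu>) * \<Phi> (E \<mu>) $$ (x mod k, y mod k) = ?C \<mu> $$ (x, y)"
        using xy by simp
    qed
    also have "\<dots> = mat_sum ?N ?C ?S $$ (x, y)" using xy by simp
    finally show "block_matrix (r + 1) k (\<lambda>i j. \<Phi> (?M (i + j - 2))) $$ (x, y) = mat_sum ?N ?C ?S $$ (x, y)" .
  qed (simp_all add: block_matrix_def)
  moreover have "psd (mat_sum ?N ?C ?S)"
  proof (rule psd_mat_sum)
    fix \<mu> assume "\<mu> \<in> ?S"
    \<comment> \<open>For \<open>k = 0\<close> the range of \<open>x\<close> is empty.\<close>
    have "x mod k < k" if "x < ?N" for x using that by (cases k) auto
    then show "psd (?C \<mu>)" by (rule psd_weighted_reindex[OF \<Phi>psd[OF \<open>\<mu> \<in> ?S\<close>] \<Phi>E])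
  qed simp
  ultimately show "psd (block_matrix (r + 1) k (\<lambda>i j. \<Phi> (?M (i + j - 2))))" by simp
qed

end
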